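(* Let $Y$ be a finite-dimensional real Hilbert space and let $\alpha>0$. Then the prox operator of the function $$h\colon Y\times Y\to\mathbb{R}\colon (x,y)\mapsto \alpha\tfrac{1}{2}\|x-y\|^2$$ is given by $$\operatorname{Prox}_h\colon (x,y)\mapsto \frac{1}{2\alpha+1}\big((1+\alpha)x+\alpha y,\ \alpha x+(1+\alpha)y\big).$$ Moreover, $\nabla h\colon (x,y)\mapsto \big(\alpha(x-y),\alpha(y-x)\big)$ is $(1+2\alpha)$-Lipschitz continuous.
   Context: $Y$ is a finite-dimensional real Hilbert space with inner product $\langle\cdot,\cdot\rangle$ and induced norm $\|\cdot\|$. The space $Y\times Y$ carries the product Hilbert space structure, $\langle (u,v),(x,y)\rangle=\langle u,x\rangle+\langle v,y\rangle$, so $\|(x,y)\|^2=\|x\|^2+\|y\|^2$. For a convex, lower semicontinuous, proper function $f$ on a Hilbert space, $\operatorname{Prox}_f(z)$ denotes the unique minimizer of $w\mapsto f(w)+\tfrac12\|z-w\|^2$. *)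

theory Defs
  imports "HOL-Analysis.Analysis"
begin

text \<open>The functions are extended-real-valued, as is usual for proper convex functions. The value
  is only meaningful when the minimizer exists uniquely (for instance, for proper, convex and
  lower semicontinuous \<open>f\<close> on a Hilbert space); otherwise the description operator leaves it
  unspecified.\<close>

definition is_prox :: "('a::real_inner \<Rightarrow> ereal) \<Rightarrow> 'a \<Rightarrow> 'a \<Rightarrow> bool" where
  "is_prox f z p \<longleftrightarrow>
     is_arg_min (\<lambda>w. f w + ereal (1/2 * (norm (z - w))\<^sup>2)) (\<lambda>_. True) p"

definition Prox :: "('a::real_inner \<Rightarrow> ereal) \<Rightarrow> 'a \<Rightarrow> 'a" where
  "Prox f z = (THE p. is_prox f z p)"

end

theory Submission
  imports Defs
begin

text \<open>Everything follows from \<open>h\<close> being a nonnegative quadratic form. A point \<open>(p, q)\<close> is critical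
  for \<open>w \<mapsto> h w + 1/2 \<parallel>z - w\<parallel>\<^sup>2\<close> exactly if \<open>z = (p, q) + \<nabla>h (p, q)\<close>. Completing the square around
  such a point, the first-order terms cancel and the objective exceeds its value at \<open>(p, q)\<close> by
  \<open>h (w - (p, q)) + 1/2 \<parallel>w - (p, q)\<parallel>\<^sup>2\<close>, so that \<open>(p, q)\<close> is the only minimizer
  (\<open>is_prox_half_sqnorm_diff_iff\<close>). The equation for \<open>(p, q)\<close> is a two-by-two linear system with
  determinant \<open>2 \<alpha> + 1\<close>; solving it gives the formula for the prox operator. The gradient is
  linear with \<open>\<parallel>\<nabla>h (a, b)\<parallel>\<^sup>2 = 2 \<alpha>\<^sup>2 \<parallel>a - b\<parallel>\<^sup>2 \<le> 4 \<alpha>\<^sup>2 \<parallel>(a, b)\<parallel>\<^sup>2\<close>, whence it is even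
  \<open>2 \<alpha>\<close>-Lipschitz.\<close>

text \<open>Writing \<open>z\<close> as \<open>(p, q)\<close> plus the gradient at \<open>(p, q)\<close> makes the first-order terms of the
  expansion around \<open>(p, q)\<close> vanish, so that the gap is the purely quadratic part.\<close>

lemma prox_objective_expansion:
  fixes p q u v :: "'a::real_inner" and \<alpha> :: real
  defines "z \<equiv> (p + \<alpha> *\<^sub>R (p - q), q + \<alpha> *\<^sub>R (q - p))"
  shows "\<alpha> * (1/2) * (norm (u - v))\<^sup>2 + 1/2 * (norm (z - (u, v)))\<^sup>2 =
    \<alpha> * (1/2) * (norm (p - q))\<^sup>2 + 1/2 * (norm (z - (p, q)))\<^sup>2
    + (\<alpha> * (1/2) * (norm ((u - v) - (p - q)))\<^sup>2 + 1/2 * (norm ((u, v) - (p, q)))\<^sup>2)"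
proof -
  define a b where "a = u - p" and "b = v - q"
  have uv: "u = p + a" "v = q + b"
    by (simp_all add: a_def b_def)
  show ?thesis
    unfolding uv z_def
    by (simp add: power2_norm_eq_inner algebra_simps inner_commute)
qed

lemma is_prox_half_sqnorm_diff_iff:
  fixes x y :: "'a::real_inner"
  assumes "\<alpha> > 0"
  shows "is_prox (\<lambda>w. ereal ((\<lambda>(x, y). \<alpha> * (1/2) * (norm (x - y))\<^sup>2) w)) (x, y) r \<longleftrightarrow>
    r = (1 / (2 * \<alpha> + 1)) *\<^sub>R ((1 + \<alpha>) *\<^sub>R x + \<alpha> *\<^sub>R y, \<alpha> *\<^sub>R x + (1 + \<alpha>) *\<^sub>R y)"
proof -
  define F where
    "F w = (case w of (u, v) \<Rightarrow> \<alpha> * (1/2) * (norm (u - v))\<^sup>2) + 1/2 * (norm ((x, y) - w))\<^sup>2"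
    for w :: "'a \<times> 'a"
  define k where "k = 1 / (2 * \<alpha> + 1)"
  define p where "p = k *\<^sub>R ((1 + \<alpha>) *\<^sub>R x + \<alpha> *\<^sub>R y)"
  define q where "q = k *\<^sub>R (\<alpha> *\<^sub>R x + (1 + \<alpha>) *\<^sub>R y)"
  have k: "k + 2 * \<alpha> * k = 1"
    using assms by (simp add: k_def field_simps)
  have pq: "p - q = k *\<^sub>R (x - y)"
    by (simp add: p_def q_def algebra_simps)
  have k1: "k *\<^sub>R c + (2 * \<alpha> * k) *\<^sub>R c = c" for c :: 'a
    using k by (metis scaleR_add_left scaleR_one)
  have x: "x = p + \<alpha> *\<^sub>R (p - q)"
    unfolding pq unfolding p_def using k1[of x] by (simp add: algebra_simps flip: scaleR_add_left)
  have y: "y = q + \<alpha> *\<^sub>R (q - p)"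
    unfolding minus_diff_eq[of p q, symmetric] pq unfolding q_def
    using k1[of y] by (simp add: algebra_simps flip: scaleR_add_left)
  have gap: "F w \<ge> F (p, q) + 1/2 * (norm (w - (p, q)))\<^sup>2" for w
  proof (cases w)
    case (Pair u v)
    show ?thesis
      using prox_objective_expansion[of \<alpha> u v p q] assms
      by (simp add: Pair F_def flip: x y)
  qed
  have "(\<forall>w. F r \<le> F w) \<longleftrightarrow> r = (p, q)"
  proof
    assume "\<forall>w. F r \<le> F w"
    then have "F r \<le> F (p, q)"
      by blast
    with gap[of r] have "(norm (r - (p, q)))\<^sup>2 \<le> 0"
      by linarith
    then show "r = (p, q)"
      by simp
  next
    assume r: "r = (p, q)"
    show "\<forall>w. F r \<le> F w"
    proof
      fix w
      show "F r \<le> F w"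
        using gap[of w] zero_le_power2[of "norm (w - (p, q))"] unfolding r by linarith
    qed
  qed
  moreover have "(p, q) = k *\<^sub>R ((1 + \<alpha>) *\<^sub>R x + \<alpha> *\<^sub>R y, \<alpha> *\<^sub>R x + (1 + \<alpha>) *\<^sub>R y)"
    by (simp add: p_def q_def)
  ultimately show ?thesis
    by (simp add: is_prox_def is_arg_min_linorder F_def k_def split_beta)
qed

lemma GDERIV_half_sqnorm_diff:
  fixes x y :: "'a::real_inner"
  shows "GDERIV (\<lambda>(x, y). \<alpha> * (1/2) * (norm (x - y))\<^sup>2) (x, y) :>
    (\<alpha> *\<^sub>R (x - y), \<alpha> *\<^sub>R (y - x))"
  unfolding gderiv_def split_beta power2_norm_eq_inner
  by (auto intro!: derivative_eq_intros simp: inner_commute algebra_simps)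

lemma norm_diff_le_norm_Pair:
  fixes a b :: "'a::real_inner"
  shows "(norm (a - b))\<^sup>2 \<le> 2 * (norm (a, b))\<^sup>2"
proof -
  \<comment> \<open>the parallelogram law with one diagonal dropped\<close>
  have "2 * (norm (a, b))\<^sup>2 - (norm (a - b))\<^sup>2 = (norm (a + b))\<^sup>2"
    by (simp add: power2_norm_eq_inner algebra_simps inner_commute)
  then show ?thesis
    by (smt (verit) zero_le_power2)
qed

lemma lipschitz_gradient_half_sqnorm_diff:
  assumes "\<alpha> \<ge> 0"
  shows "(2 * \<alpha>)-lipschitz_on UNIV
    (\<lambda>(x :: 'a::real_inner, y :: 'a). (\<alpha> *\<^sub>R (x - y), \<alpha> *\<^sub>R (y - x)))"
proof (rule lipschitz_onI)
  have *: "norm (\<alpha> *\<^sub>R (a - b), \<alpha> *\<^sub>R (b - a)) \<le> 2 * \<alpha> * norm (a, b)" for a b :: 'a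
  proof (rule power2_le_imp_le)
    have "(norm (\<alpha> *\<^sub>R (a - b), \<alpha> *\<^sub>R (b - a)))\<^sup>2 = 2 * \<alpha>\<^sup>2 * (norm (a - b))\<^sup>2"
      by (simp add: norm_Pair power_mult_distrib norm_minus_commute)
    also have "\<dots> \<le> 2 * \<alpha>\<^sup>2 * (2 * (norm (a, b))\<^sup>2)"
      by (intro mult_left_mono norm_diff_le_norm_Pair) simp
    finally show "(norm (\<alpha> *\<^sub>R (a - b), \<alpha> *\<^sub>R (b - a)))\<^sup>2 \<le> (2 * \<alpha> * norm (a, b))\<^sup>2"
      by (simp add: power_mult_distrib)
  qed (use assms in simp)
  fix s t :: "'a \<times> 'a"
  \<comment> \<open>by linearity it suffices to bound the gradient at \<open>s - t\<close>\<close>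
  show "dist (case s of (x, y) \<Rightarrow> (\<alpha> *\<^sub>R (x - y), \<alpha> *\<^sub>R (y - x)))
      (case t of (x, y) \<Rightarrow> (\<alpha> *\<^sub>R (x - y), \<alpha> *\<^sub>R (y - x))) \<le> 2 * \<alpha> * dist s t"
    using *[of "fst s - fst t" "snd s - snd t"]
    by (cases s; cases t) (simp add: dist_norm algebra_simps)
qed (use assms in simp)

theorem proposition4p1:
  fixes B :: "'a::{real_inner, complete_space} set"
    and \<alpha> :: real
    and h :: "'a \<times> 'a \<Rightarrow> real"
  assumes finite_dimensional: "finite B" "span B = UNIV"
    and "\<alpha> > 0"
    and h: "h = (\<lambda>(x, y). \<alpha> * (1/2) * (norm (x - y))\<^sup>2)"
  shows "(\<forall>z. \<exists>!p. is_prox (\<lambda>w. ereal (h w)) z p)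
    \<and> Prox (\<lambda>w. ereal (h w)) =
        (\<lambda>(x, y). (1 / (2 * \<alpha> + 1)) *\<^sub>R
           ((1 + \<alpha>) *\<^sub>R x + \<alpha> *\<^sub>R y, \<alpha> *\<^sub>R x + (1 + \<alpha>) *\<^sub>R y))
    \<and> (\<forall>x y. GDERIV h (x, y) :> (\<alpha> *\<^sub>R (x - y), \<alpha> *\<^sub>R (y - x)))
    \<and> (1 + 2 * \<alpha>)-lipschitz_on UNIV (\<lambda>(x :: 'a, y :: 'a). (\<alpha> *\<^sub>R (x - y), \<alpha> *\<^sub>R (y - x)))"
proof (intro conjI allI)
  note iff = is_prox_half_sqnorm_diff_iff[where 'a = 'a, OF \<open>\<alpha> > 0\<close>, folded h]
  show "\<exists>!p. is_prox (\<lambda>w. ereal (h w)) z p" for z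
    unfolding iff[of "fst z" "snd z", unfolded prod.collapse] by blast
  show "Prox (\<lambda>w. ereal (h w)) =
        (\<lambda>(x, y). (1 / (2 * \<alpha> + 1)) *\<^sub>R
           ((1 + \<alpha>) *\<^sub>R x + \<alpha> *\<^sub>R y, \<alpha> *\<^sub>R x + (1 + \<alpha>) *\<^sub>R y))"
    unfolding Prox_def by (rule ext, clarify, rule the_equality) (simp_all only: iff)
  show "GDERIV h (x, y) :> (\<alpha> *\<^sub>R (x - y), \<alpha> *\<^sub>R (y - x))" for x y
    unfolding h by (rule GDERIV_half_sqnorm_diff)
  show "(1 + 2 * \<alpha>)-lipschitz_on UNIV (\<lambda>(x :: 'a, y :: 'a). (\<alpha> *\<^sub>R (x - y), \<alpha> *\<^sub>R (y - x)))"
    using \<open>\<alpha> > 0\<close> by (intro lipschitz_on_le[OF lipschitz_gradient_half_sqnorm_diff]) auto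
qed

end
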